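(* Suppose $A \in \mathcal{M}_n^{+}$ has factor width $k \geq 2$. Let $G$ be the graph on the vertex set $\{1,\ldots,n\}$ that contains $\{i,j\}$ ($i \neq j$) as an edge if and only if $a_{i,j} \neq 0$. Then $\mathrm{fran}_k(A) \geq \mathrm{cc}_k(G)$.
   Context: Let $\mathbb{F} \in \{\mathbb{R},\mathbb{C}\}$ (the result holds for either field). $\mathcal{M}_n^{+}$ denotes the set of $n \times n$ positive semidefinite (real symmetric if $\mathbb{F}=\mathbb{R}$, Hermitian if $\mathbb{F}=\mathbb{C}$) matrices over $\mathbb{F}$. The factor width of $A \in \mathcal{M}_n^{+}$ is the smallest positive integer $k$ such that $A = \sum_{j=1}^r \mathbf{v}_j\mathbf{v}_j^*$ for some $r$ and some $\mathbf{v}_1,\ldots,\mathbf{v}_r \in \mathbb{F}^n$, each with at most $k$ non-zero entries. If $A$ has factor width at most $k$, $\mathrm{fran}_k(A)$ (the factor-width-$k$ rank) is the least integer $r$ for which such a decomposition with vectors having at most $k$ non-zero entries exists. A $k$-clique covering of a graph $G$ is a collection of cliques of size $k$ on vertices of $G$ (i.e., complete graphs on $k$-element subsets of the vertex set; they need not be subgraphs of $G$ and may use edges that $G$ does not have) such that every edge of $G$ is contained in at least one of them; $\mathrm{cc}_k(G)$ is the minimum number of $k$-cliques in a $k$-clique covering of $G$. *)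

theory Defs
  imports
    "Jordan_Normal_Form.Schur_Decomposition"
    "HOL-Library.Extended_Nat"
    "HOL-Library.Ramsey"
begin

text \<open>
  The matrix notions are polymorphic; they are meant for the scalar types \<^typ>\<open>real\<close> and
  \<^typ>\<open>complex\<close>, on which \<^const>\<open>conjugate\<close> is the identity and complex conjugation,
  respectively. On \<^typ>\<open>complex\<close>, the order is the one of \<^theory>\<open>HOL-Library.Complex_Order\<close>,
  so \<open>0 \<le> z\<close> says that \<open>z\<close> is real and nonnegative. Indices run from \<open>0\<close> to \<open>n - 1\<close>.
\<close>

definition psd_mats :: "nat \<Rightarrow> 'a :: conjugatable_ordered_field mat set" where
  "psd_mats n = {A \<in> carrier_mat n n.
     mat_adjoint A = A \<and> (\<forall>v \<in> carrier_vec n. 0 \<le> (A *\<^sub>v v) \<bullet>c v)}"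

text \<open>The matrix \<open>v v\<^sup>*\<close>, for a column vector \<open>v\<close>.\<close>

definition self_outer :: "'a :: conjugatable_ordered_field vec \<Rightarrow> 'a mat" where
  "self_outer v = mat (dim_vec v) (dim_vec v) (\<lambda>(i, j). v $ i * conjugate (v $ j))"

definition nonzero_entries :: "'a :: zero vec \<Rightarrow> nat set" where
  "nonzero_entries v = {i. i < dim_vec v \<and> v $ i \<noteq> 0}"

definition width_decomposition ::
    "nat \<Rightarrow> 'a :: conjugatable_ordered_field mat \<Rightarrow> 'a vec list \<Rightarrow> bool" where
  "width_decomposition k A vs \<longleftrightarrow>
     (\<forall>v \<in> set vs. v \<in> carrier_vec (dim_row A) \<and> card (nonzero_entries v) \<le> k) \<and>
     A = foldr (\<lambda>v M. self_outer v + M) vs (0\<^sub>m (dim_row A) (dim_row A))"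

text \<open>
  The minima below are taken in \<^typ>\<open>enat\<close>, so the minimum of an empty set of candidates
  is \<open>\<infinity>\<close> and a finite value is always attained.
\<close>

definition factor_width :: "'a :: conjugatable_ordered_field mat \<Rightarrow> enat" where
  "factor_width A = (INF k \<in> {k. 0 < k \<and> (\<exists>vs. width_decomposition k A vs)}. enat k)"

definition fran :: "nat \<Rightarrow> 'a :: conjugatable_ordered_field mat \<Rightarrow> enat" where
  "fran k A = (INF vs \<in> {vs. width_decomposition k A vs}. enat (length vs))"

text \<open>A graph is a pair of a vertex set and a set of edges, each a two-element set of vertices.\<close>

type_synonym 'v graph = "'v set \<times> 'v set set"

definition graph_of_mat :: "'a :: zero mat \<Rightarrow> nat graph" where
  "graph_of_mat A =
     ({..<dim_row A},
      {{i, j} | i j. i < dim_row A \<and> j < dim_row A \<and> i \<noteq> j \<and> A $$ (i, j) \<noteq> 0})"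

text \<open>
  A \<open>k\<close>-clique is represented by its vertex set. It need not be a subgraph of the given graph.
\<close>

definition clique_covering :: "nat \<Rightarrow> 'v graph \<Rightarrow> 'v set set \<Rightarrow> bool" where
  "clique_covering k G C \<longleftrightarrow>
     finite C \<and> C \<subseteq> nsets (fst G) k \<and> (\<forall>e \<in> snd G. \<exists>S \<in> C. e \<subseteq> S)"

definition cc :: "nat \<Rightarrow> 'v graph \<Rightarrow> enat" where
  "cc k G = (INF C \<in> {C. clique_covering k G C}. enat (card C))"

end

theory Submission
  imports Defs
begin

text \<open>
  Each vector of a decomposition \<open>A = \<Sum> v v\<^sup>*\<close> of width \<open>k\<close> pays for one \<open>k\<close>-clique. The
  \<open>(i, j)\<close> entry of \<open>A\<close> is the sum of the terms \<open>v\<^sub>i\<close> times the conjugate of \<open>v\<^sub>j\<close>, so if it is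
  non-zero then some \<open>v\<close> has both \<open>i\<close> and \<open>j\<close> in its support. The supports therefore cover all
  edges of the graph of \<open>A\<close>. They have at most \<open>k\<close> elements, and enlarging each of them to a
  \<open>k\<close>-element vertex set yields a \<open>k\<close>-clique covering with at most as many cliques as there are
  vectors (\<open>cc_le_length_decomposition\<close>).

  The enlargement needs \<open>k \<le> n\<close>. This is where the hypothesis that the factor width is exactly
  \<open>k\<close>, and not merely at most \<open>k\<close>, enters: a vector of length \<open>n\<close> has at most \<open>n\<close> non-zero
  entries, so the factor width never exceeds \<open>n\<close>, apart from the degenerate case \<open>n = 0\<close>, which
  \<open>k \<ge> 2\<close> excludes (\<open>factor_width_le_dim\<close>).
\<close>

lemma nonzero_entries_subset: "nonzero_entries v \<subseteq> {..<dim_vec v}"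
  by (auto simp: nonzero_entries_def)

lemma foldr_self_outer_carrier:
  assumes "\<forall>v \<in> set vs. v \<in> carrier_vec n"
  shows "foldr (\<lambda>v M. self_outer v + M) vs (0\<^sub>m n n) \<in> carrier_mat n n"
  using assms by (induction vs) (auto simp: self_outer_def)

lemma foldr_self_outer_nonzero_entry:
  assumes "\<forall>v \<in> set vs. v \<in> carrier_vec n" and "i < n" "j < n"
    and "foldr (\<lambda>v M. self_outer v + M) vs (0\<^sub>m n n) $$ (i, j) \<noteq> 0"
  shows "\<exists>v \<in> set vs. {i, j} \<subseteq> nonzero_entries v"
  using assms
proof (induction vs)
  case Nil
  then show ?case by simp
next
  case (Cons v vs)
  let ?M = "foldr (\<lambda>v M. self_outer v + M) vs (0\<^sub>m n n)"
  have v: "dim_vec v = n" using Cons.prems(1) by auto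
  have M: "?M \<in> carrier_mat n n"
    using Cons.prems(1) by (intro foldr_self_outer_carrier) auto
  have "v $ i * conjugate (v $ j) + ?M $$ (i, j) \<noteq> 0"
    using Cons.prems(2-4) v M by (simp add: self_outer_def)
  then consider "v $ i * conjugate (v $ j) \<noteq> 0" | "?M $$ (i, j) \<noteq> 0"
    by force
  then show ?case
  proof cases
    case 1
    then have "v $ i \<noteq> 0" "v $ j \<noteq> 0" by auto
    then have "{i, j} \<subseteq> nonzero_entries v"
      using v Cons.prems(2,3) by (auto simp: nonzero_entries_def)
    then show ?thesis by auto
  next
    case 2
    then show ?thesis using Cons.IH Cons.prems by auto
  qed
qed

text \<open>
  The maximum with \<open>1\<close> accounts for the empty matrix: its factor width is \<open>1\<close>, because factor
  widths are positive by definition.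
\<close>

lemma factor_width_le_dim:
  assumes "width_decomposition k A vs"
  shows "factor_width A \<le> enat (max 1 (dim_row A))"
proof -
  have "card (nonzero_entries v) \<le> dim_row A" if "v \<in> set vs" for v
    using that assms card_mono[OF _ nonzero_entries_subset[of v]]
    by (auto simp: width_decomposition_def)
  then have "width_decomposition (max 1 (dim_row A)) A vs"
    using assms by (auto simp: width_decomposition_def le_max_iff_disj)
  then show ?thesis
    unfolding factor_width_def by (intro INF_lower) auto
qed

lemma cc_le_length_decomposition:
  assumes dec: "width_decomposition k A vs" and k: "k \<le> dim_row A"
  shows "cc k (graph_of_mat A) \<le> enat (length vs)"
proof -
  have vs: "\<forall>v \<in> set vs. v \<in> carrier_vec (dim_row A)"
    and A: "A = foldr (\<lambda>v M. self_outer v + M) vs (0\<^sub>m (dim_row A) (dim_row A))"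
    using dec by (auto simp: width_decomposition_def)
  have "\<exists>S. nonzero_entries v \<subseteq> S \<and> S \<in> nsets {..<dim_row A} k" if "v \<in> set vs" for v
  proof -
    have "dim_vec v = dim_row A" using that vs by auto
    then have "card (nonzero_entries v) \<le> k" "nonzero_entries v \<subseteq> {..<dim_row A}"
      using that dec nonzero_entries_subset[of v] by (simp_all add: width_decomposition_def)
    then obtain S where "nonzero_entries v \<subseteq> S" "S \<subseteq> {..<dim_row A}" "card S = k"
      using exists_subset_between[of "nonzero_entries v" k "{..<dim_row A}"] k by auto
    then show ?thesis
      by (auto simp: nsets_def intro: finite_subset)
  qed
  then obtain S where
    S: "\<And>v. v \<in> set vs \<Longrightarrow> nonzero_entries v \<subseteq> S v \<and> S v \<in> nsets {..<dim_row A} k"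
    by metis
  have "\<exists>T \<in> S ` set vs. {i, j} \<subseteq> T"
    if "i < dim_row A" "j < dim_row A" "A $$ (i, j) \<noteq> 0" for i j
  proof -
    have "\<exists>v \<in> set vs. {i, j} \<subseteq> nonzero_entries v"
      using foldr_self_outer_nonzero_entry[OF vs that(1,2)] that(3) A by simp
    then show ?thesis using S by blast
  qed
  then have "clique_covering k (graph_of_mat A) (S ` set vs)"
    using S by (fastforce simp: clique_covering_def graph_of_mat_def)
  then have "cc k (graph_of_mat A) \<le> enat (card (S ` set vs))"
    unfolding cc_def by (intro INF_lower) auto
  also have "card (S ` set vs) \<le> length vs"
    using card_image_le[of "set vs" S] card_length[of vs] by simp
  finally show ?thesis by simp
qed

lemma cc_le_fran:
  assumes "factor_width A = enat k" and "k \<ge> 2"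
  shows "cc k (graph_of_mat A) \<le> fran k A"
  unfolding fran_def
proof (intro INF_greatest)
  fix vs assume "vs \<in> {vs. width_decomposition k A vs}"
  then have dec: "width_decomposition k A vs" by simp
  have "k \<le> dim_row A"
    using factor_width_le_dim[OF dec] assms by (simp add: le_max_iff_disj)
  then show "cc k (graph_of_mat A) \<le> enat (length vs)"
    by (rule cc_le_length_decomposition[OF dec])
qed

theorem proposition7:
  fixes n k :: nat
  assumes "k \<ge> 2"
  shows "(\<forall>A :: real mat. A \<in> psd_mats n \<and> factor_width A = enat k \<longrightarrow>
            fran k A \<ge> cc k (graph_of_mat A)) \<and>
         (\<forall>A :: complex mat. A \<in> psd_mats n \<and> factor_width A = enat k \<longrightarrow>
            fran k A \<ge> cc k (graph_of_mat A))"
  using assms by (auto intro: cc_le_fran)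

end
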